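(* Let $H$ be the set of all derivations of $A$ (i.e. $K$-linear maps $L:A\to A$ with $L(\psi\varphi)=\psi L\varphi+\varphi L\psi$ for all $\psi,\varphi\in A$), regarded as a vector space over $A$. Then the set $B=\{\partial_1,\dots,\partial_n\}$ is a basis of $H$ over $A$, so $\dim_A H=n$, and every $L\in H$ has the form $L=a_1\partial_1+\cdots+a_n\partial_n$ with $a_i=L x_i$. Consequently the correspondence $L=\sum_{i=1}^n a_i\partial_i\mapsto (a_1,\dots,a_n)$ is an isomorphism of $A$-vector spaces from $H$ onto $A^n$, and $L\phi=\langle (a_1,\dots,a_n)\mid\nabla\phi\rangle$ for every $\phi\in A$.
   Context: $A$ is a field of characteristic $0$, and $K\cong\mathbb{Q}$ is its subfield generated by $1$. $A$ is generated as a field by a set $\{x_1,\dots,x_n\}$ of $n$ distinct elements, different from $0$ and $1$, which is functionally (equivalently, algebraically) independent over $K$: no nonzero polynomial with coefficients in $K$ vanishes at $(x_1,\dots,x_n)$. Thus every element of $A$ has the form $P_1P_2^{-1}$ with $P_1,P_2$ polynomials in $x_1,\dots,x_n$ over $K$, $P_2\neq 0$. $A$ is also assumed to carry a partial order $\le$ such that $\psi_1>\psi_2$ and $\varphi_1\ge\varphi_2$ imply $\psi_1+\varphi_1>\psi_2+\varphi_2$, and $\psi^2\ge 0$ for all $\psi\in A$. $\partial_1,\dots,\partial_n$ denote the derivations of $A$ satisfying $\partial_i x_j=\delta_{ij}$. The gradient is $\nabla\phi=(\partial_1\phi,\dots,\partial_n\phi)\in A^n$, and $\langle (a_1,\dots,a_n)\mid(b_1,\dots,b_n)\rangle=\sum_{i=1}^n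 a_ib_i$ on $A^n$. *)

theory Defs
  imports
    "HOL-Analysis.Cartesian_Space"
    "HOL-Library.Poly_Mapping"
    "HOL-Library.Function_Algebras"
begin

section \<open>Subfields, generation, algebraic independence\<close>

definition is_subfield :: "'a::field set \<Rightarrow> bool" where
  "is_subfield S \<longleftrightarrow> 0 \<in> S \<and> 1 \<in> S
     \<and> (\<forall>a\<in>S. \<forall>b\<in>S. a + b \<in> S \<and> a * b \<in> S)
     \<and> (\<forall>a\<in>S. - a \<in> S \<and> inverse a \<in> S)"

definition subfield_generated :: "'a::field set \<Rightarrow> 'a set" where
  "subfield_generated X = is_subfield hull X"

definition prime_field :: "'a::field set" where
  "prime_field = subfield_generated {1}"

lemma is_subfield_subfield_generated: "is_subfield (subfield_generated X)"
  unfolding subfield_generated_def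
  by (rule hull_in) (unfold is_subfield_def, blast)

lemma prime_field_eq_Rats: "(prime_field :: 'a::field_char_0 set) = \<rat>"
proof
  have "is_subfield (\<rat> :: 'a set)"
    by (auto simp: is_subfield_def)
  then show "(prime_field :: 'a set) \<subseteq> \<rat>"
    unfolding prime_field_def subfield_generated_def by (intro hull_minimal) auto
next
  have sf: "is_subfield (prime_field :: 'a set)"
    unfolding prime_field_def by (rule is_subfield_subfield_generated)
  have nat: "of_nat k \<in> (prime_field :: 'a set)" for k
    using sf by (induction k) (auto simp: is_subfield_def)
  have int: "of_int z \<in> (prime_field :: 'a set)" for z
    using sf nat by (cases z rule: int_cases2) (auto simp: is_subfield_def)
  show "\<rat> \<subseteq> (prime_field :: 'a set)"
  proof
    fix a :: 'a assume "a \<in> \<rat>"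
    then obtain p q where "a = of_int p / of_int q"
      by (auto elim: Rats_cases')
    then show "a \<in> prime_field"
      using sf int[of p] int[of q] by (auto simp: is_subfield_def divide_inverse)
  qed
qed

text \<open>
  A polynomial in indeterminates indexed by \<open>'n\<close> is a finitely supported map from
  monomials (exponent vectors) to coefficients.
\<close>

definition eval_poly :: "(('n::finite \<Rightarrow>\<^sub>0 nat) \<Rightarrow>\<^sub>0 'a::field) \<Rightarrow> ('n \<Rightarrow> 'a) \<Rightarrow> 'a" where
  "eval_poly p x = (\<Sum>m\<in>Poly_Mapping.keys p.
     Poly_Mapping.lookup p m * (\<Prod>i\<in>UNIV. x i ^ Poly_Mapping.lookup m i))"

definition functionally_independent :: "'a set \<Rightarrow> ('n::finite \<Rightarrow> 'a::field) \<Rightarrow> bool" where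
  "functionally_independent K x \<longleftrightarrow>
     (\<forall>p. (\<forall>m. Poly_Mapping.lookup p m \<in> K) \<and> p \<noteq> 0 \<longrightarrow> eval_poly p x \<noteq> 0)"


section \<open>Derivations\<close>

definition is_derivation :: "('a::field \<Rightarrow> 'a) \<Rightarrow> bool" where
  "is_derivation L \<longleftrightarrow>
     (\<forall>\<psi> \<phi>. L (\<psi> + \<phi>) = L \<psi> + L \<phi>)
     \<and> (\<forall>c\<in>prime_field. \<forall>\<phi>. L (c * \<phi>) = c * L \<phi>)
     \<and> (\<forall>\<psi> \<phi>. L (\<psi> * \<phi>) = \<psi> * L \<phi> + \<phi> * L \<psi>)"

definition derivations :: "('a::field \<Rightarrow> 'a) set" where
  "derivations = {L. is_derivation L}"

text \<open>
  The derivations form an \<open>'a\<close>-subspace of the space of all maps \<open>'a \<Rightarrow> 'a\<close> with pointwise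
  operations.
\<close>

definition scale_map :: "'a::field \<Rightarrow> ('a \<Rightarrow> 'a) \<Rightarrow> ('a \<Rightarrow> 'a)" where
  "scale_map c L = (\<lambda>\<phi>. c * L \<phi>)"

global_interpretation maps: vector_space scale_map
  by unfold_locales (auto simp: scale_map_def fun_eq_iff algebra_simps)

lemma subspace_derivations: "maps.subspace derivations"
  by (auto simp: maps.subspace_def derivations_def is_derivation_def scale_map_def algebra_simps)

text \<open>
  Meaningful when \<open>x\<close> generates \<open>'a\<close> and is functionally independent over the prime field:
  then such a derivation exists and is unique.
\<close>

definition partial :: "('n \<Rightarrow> 'a::field) \<Rightarrow> 'n \<Rightarrow> 'a \<Rightarrow> 'a" where
  "partial x i = (THE D. is_derivation D \<and> (\<forall>j. D (x j) = (if i = j then 1 else 0)))"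

definition gradient :: "('n::finite \<Rightarrow> 'a::field) \<Rightarrow> 'a \<Rightarrow> 'a ^ 'n" where
  "gradient x \<phi> = (\<chi> i. partial x i \<phi>)"

definition pairing :: "'a::field ^ 'n::finite \<Rightarrow> 'a ^ 'n \<Rightarrow> 'a" where
  "pairing a b = (\<Sum>i\<in>UNIV. a $ i * b $ i)"

definition coords :: "('n::finite \<Rightarrow> 'a::field) \<Rightarrow> ('a \<Rightarrow> 'a) \<Rightarrow> 'a ^ 'n" where
  "coords x L = (\<chi> i. maps.representation (range (partial x)) L (partial x i))"

definition linear_iso_on ::
  "('k \<Rightarrow> 'v \<Rightarrow> 'v) \<Rightarrow> ('k \<Rightarrow> 'w \<Rightarrow> 'w) \<Rightarrow> 'v::plus set \<Rightarrow> 'w::plus set \<Rightarrow> ('v \<Rightarrow> 'w) \<Rightarrow> bool" where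
  "linear_iso_on s t V W f \<longleftrightarrow>
     (\<forall>u\<in>V. \<forall>v\<in>V. f (u + v) = f u + f v)
     \<and> (\<forall>c. \<forall>v\<in>V. f (s c v) = t c (f v))
     \<and> bij_betw f V W"

end

theory Submission
  imports Defs
begin

text \<open>
  A derivation is determined by its values on the generators \<open>x\<^sub>j\<close>, because two derivations
  agree on a subfield (\<open>derivation_eqI\<close>). Conversely any values \<open>b\<^sub>j\<close> at the \<open>x\<^sub>j\<close> are attained
  by a derivation (\<open>derivation_extension\<close>): every element of the field is a quotient \<open>P(x) / Q(x)\<close>
  of polynomials over the prime field, and the quotient rule prescribes the value there. It does
  not depend on the representation because a polynomial that vanishes at \<open>x\<close> is zero by
  functional independence, so its formal derivative is zero as well.

  Hence \<open>L \<mapsto> (L x\<^sub>j)\<^sub>j\<close> is a bijection from the derivations onto the \<open>n\<close>-tuples, and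
  \<open>\<partial>\<^sub>1, \<dots>, \<partial>\<^sub>n\<close> correspond to the standard basis. Everything claimed about bases, coordinates
  and gradients follows by evaluating linear combinations of the \<open>\<partial>\<^sub>i\<close> at the \<open>x\<^sub>j\<close>.
\<close>

section \<open>Linear functionals on polynomials\<close>

text \<open>The linear extension to polynomials of a function \<open>h\<close> prescribed on the monomials.\<close>

definition lin_ext :: "('m \<Rightarrow> 'a) \<Rightarrow> ('m \<Rightarrow>\<^sub>0 'a) \<Rightarrow> 'a::comm_ring_1" where
  "lin_ext h p = (\<Sum>m\<in>Poly_Mapping.keys p. Poly_Mapping.lookup p m * h m)"

lemma lin_ext_superset:
  assumes "finite A" "Poly_Mapping.keys p \<subseteq> A"
  shows "lin_ext h p = (\<Sum>m\<in>A. Poly_Mapping.lookup p m * h m)"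
  unfolding lin_ext_def
  by (rule sum.mono_neutral_left) (use assms in \<open>auto simp: in_keys_iff\<close>)

lemma lin_ext_0 [simp]: "lin_ext h 0 = 0"
  by (simp add: lin_ext_def)

lemma lin_ext_add: "lin_ext h (p + q) = lin_ext h p + lin_ext h q"
proof -
  let ?A = "Poly_Mapping.keys p \<union> Poly_Mapping.keys q"
  have "Poly_Mapping.keys (p + q) \<subseteq> ?A"
    by (rule Poly_Mapping.keys_add)
  then show ?thesis
    by (simp add: lin_ext_superset[of ?A] lookup_add algebra_simps sum.distrib)
qed

lemma lin_ext_diff: "lin_ext h (p - q) = lin_ext h p - lin_ext h q"
  using lin_ext_add[of h "p - q" q] by (simp add: algebra_simps)

lemma lin_ext_sum: "lin_ext h (sum f A) = (\<Sum>a\<in>A. lin_ext h (f a))"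
  by (induction A rule: infinite_finite_induct) (auto simp: lin_ext_add)

lemma lin_ext_single: "lin_ext h (Poly_Mapping.single m c) = c * h m"
  by (simp add: lin_ext_superset[of "{m}"])

lemma lin_ext_1: "lin_ext h 1 = h 0"
  using lin_ext_single[of h 0 1] by simp

lemma poly_eq_sum_single:
  fixes p :: "'m \<Rightarrow>\<^sub>0 'a::comm_monoid_add"
  shows "p = (\<Sum>m\<in>Poly_Mapping.keys p. Poly_Mapping.single m (Poly_Mapping.lookup p m))"
proof (rule poly_mapping_eqI)
  fix k
  show "Poly_Mapping.lookup p k = Poly_Mapping.lookup
      (\<Sum>m\<in>Poly_Mapping.keys p. Poly_Mapping.single m (Poly_Mapping.lookup p m)) k"
    by (simp add: lookup_sum lookup_single when_def in_keys_iff)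
qed

lemma times_eq_sum_single:
  fixes p q :: "'m::cancel_comm_monoid_add \<Rightarrow>\<^sub>0 'a::comm_ring_1"
  shows "p * q = (\<Sum>a\<in>Poly_Mapping.keys p. \<Sum>b\<in>Poly_Mapping.keys q.
    Poly_Mapping.single (a + b) (Poly_Mapping.lookup p a * Poly_Mapping.lookup q b))"
proof -
  have "p * q = (\<Sum>a\<in>Poly_Mapping.keys p. Poly_Mapping.single a (Poly_Mapping.lookup p a))
      * (\<Sum>b\<in>Poly_Mapping.keys q. Poly_Mapping.single b (Poly_Mapping.lookup q b))"
    using poly_eq_sum_single[of p] poly_eq_sum_single[of q] by simp
  then show ?thesis
    by (simp add: sum_product mult_single)
qed

lemma lin_ext_times:
  fixes p q :: "'m::cancel_comm_monoid_add \<Rightarrow>\<^sub>0 'a::comm_ring_1"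
  shows "lin_ext h (p * q) = (\<Sum>a\<in>Poly_Mapping.keys p. \<Sum>b\<in>Poly_Mapping.keys q.
    Poly_Mapping.lookup p a * Poly_Mapping.lookup q b * h (a + b))"
  by (simp add: times_eq_sum_single[of p q] lin_ext_sum lin_ext_single)

text \<open>
  It suffices to check multiplicativity, or the Leibniz rule, on monomials. The addition of
  exponent vectors is the multiplication of monomials.
\<close>

lemma lin_ext_mult_hom:
  fixes p q :: "'m::cancel_comm_monoid_add \<Rightarrow>\<^sub>0 'a::comm_ring_1"
  assumes "\<And>a b. h (a + b) = h a * h b"
  shows "lin_ext h (p * q) = lin_ext h p * lin_ext h q"
  unfolding lin_ext_times assms lin_ext_def[of h p] lin_ext_def[of h q] sum_product
  by (simp add: mult_ac)

lemma lin_ext_mult_derivation: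
  fixes p q :: "'m::cancel_comm_monoid_add \<Rightarrow>\<^sub>0 'a::comm_ring_1"
  assumes "\<And>a b. d (a + b) = h a * d b + h b * d a"
  shows "lin_ext d (p * q) = lin_ext h p * lin_ext d q + lin_ext h q * lin_ext d p"
proof -
  have "lin_ext d (p * q) =
      (\<Sum>a\<in>Poly_Mapping.keys p. \<Sum>b\<in>Poly_Mapping.keys q.
         (Poly_Mapping.lookup p a * h a) * (Poly_Mapping.lookup q b * d b))
    + (\<Sum>a\<in>Poly_Mapping.keys p. \<Sum>b\<in>Poly_Mapping.keys q.
         (Poly_Mapping.lookup p a * d a) * (Poly_Mapping.lookup q b * h b))"
    unfolding lin_ext_times assms by (simp add: algebra_simps sum.distrib)
  also have "\<dots> = lin_ext h p * lin_ext d q + lin_ext d p * lin_ext h q"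
    by (simp add: lin_ext_def sum_product)
  finally show ?thesis by (simp add: mult_ac)
qed

section \<open>Polynomials with coefficients in a subfield\<close>

text \<open>The polynomials all of whose coefficients lie in \<open>K\<close>.\<close>

definition polys_over :: "'a::comm_ring_1 set \<Rightarrow> ('m \<Rightarrow>\<^sub>0 'a) set" where
  "polys_over K = {p. \<forall>m. Poly_Mapping.lookup p m \<in> K}"

lemma is_subfieldI:
  assumes "0 \<in> S" "1 \<in> S"
    and "\<And>a b. a \<in> S \<Longrightarrow> b \<in> S \<Longrightarrow> a + b \<in> S \<and> a * b \<in> S"
    and "\<And>a. a \<in> S \<Longrightarrow> - a \<in> S \<and> inverse a \<in> S"
  shows "is_subfield S"
  using assms by (simp add: is_subfield_def)

lemma is_subfield_diff: "is_subfield K \<Longrightarrow> a \<in> K \<Longrightarrow> b \<in> K \<Longrightarrow> a - b \<in> K"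
  unfolding is_subfield_def diff_conv_add_uminus by blast

lemma polys_over_add:
  "is_subfield K \<Longrightarrow> p \<in> polys_over K \<Longrightarrow> q \<in> polys_over K \<Longrightarrow> p + q \<in> polys_over K"
  by (simp add: polys_over_def lookup_add is_subfield_def)

lemma polys_over_diff:
  "is_subfield K \<Longrightarrow> p \<in> polys_over K \<Longrightarrow> q \<in> polys_over K \<Longrightarrow> p - q \<in> polys_over K"
  by (simp add: polys_over_def lookup_minus is_subfield_diff)

lemma polys_over_single: "is_subfield K \<Longrightarrow> c \<in> K \<Longrightarrow> Poly_Mapping.single m c \<in> polys_over K"
  by (simp add: polys_over_def lookup_single when_def is_subfield_def)

lemma polys_over_1: "is_subfield K \<Longrightarrow> 1 \<in> polys_over K"
  using polys_over_single[of K 1 0] by (simp add: is_subfield_def)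

lemma polys_over_sum:
  assumes "is_subfield K" "\<And>a. a \<in> A \<Longrightarrow> f a \<in> polys_over K"
  shows "sum f A \<in> polys_over K"
  using assms(2)
proof (induction A rule: infinite_finite_induct)
  case (insert a A)
  then show ?case by (simp add: polys_over_add assms(1))
qed (use assms(1) in \<open>auto simp: polys_over_def is_subfield_def\<close>)

lemma polys_over_times:
  fixes p q :: "'m::cancel_comm_monoid_add \<Rightarrow>\<^sub>0 'a::field"
  assumes K: "is_subfield K" and "p \<in> polys_over K" "q \<in> polys_over K"
  shows "p * q \<in> polys_over K"
  unfolding times_eq_sum_single[of p q]
  using assms by (intro polys_over_sum polys_over_single) (auto simp: polys_over_def is_subfield_def)

section \<open>Evaluation and formal derivatives\<close>

text \<open>The value of the monomial with exponent vector \<open>m\<close> at the point \<open>x\<close>.\<close>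

definition monom_val :: "('n::finite \<Rightarrow> 'a::field) \<Rightarrow> ('n \<Rightarrow>\<^sub>0 nat) \<Rightarrow> 'a" where
  "monom_val x m = (\<Prod>i\<in>UNIV. x i ^ Poly_Mapping.lookup m i)"

text \<open>
  The value at \<open>x\<close> of the derivative of the monomial \<open>m\<close> in the direction \<open>b\<close>. It is written as
  the logarithmic derivative times the value of the monomial, which presupposes that no \<open>x\<^sub>j\<close>
  vanishes.
\<close>

definition monom_deriv :: "('n::finite \<Rightarrow> 'a::field) \<Rightarrow> ('n \<Rightarrow> 'a) \<Rightarrow> ('n \<Rightarrow>\<^sub>0 nat) \<Rightarrow> 'a" where
  "monom_deriv x b m = (\<Sum>j\<in>UNIV. of_nat (Poly_Mapping.lookup m j) * b j / x j) * monom_val x m"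

lemma eval_poly_eq_lin_ext: "eval_poly p x = lin_ext (monom_val x) p"
  by (simp add: eval_poly_def lin_ext_def monom_val_def)

lemma monom_val_add: "monom_val x (a + b) = monom_val x a * monom_val x b"
  by (simp add: monom_val_def lookup_add power_add prod.distrib)

lemma monom_deriv_add:
  "monom_deriv x b (m + k) = monom_val x m * monom_deriv x b k + monom_val x k * monom_deriv x b m"
  by (simp add: monom_deriv_def monom_val_add lookup_add algebra_simps sum.distrib add_divide_distrib)

lemma monom_val_0 [simp]: "monom_val x 0 = 1"
  by (simp add: monom_val_def)

lemma monom_deriv_0 [simp]: "monom_deriv x b 0 = 0"
  by (simp add: monom_deriv_def)

lemma monom_val_single [simp]: "monom_val x (Poly_Mapping.single j 1) = x j"
proof -
  have "monom_val x (Poly_Mapping.single j 1) = (\<Prod>i\<in>UNIV. if i = j then x j else 1)"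
    unfolding monom_val_def by (rule prod.cong) (auto simp: lookup_single when_def)
  then show ?thesis by simp
qed

lemma monom_deriv_single:
  assumes "x j \<noteq> 0"
  shows "monom_deriv x b (Poly_Mapping.single j 1) = b j"
proof -
  have "(\<Sum>i\<in>UNIV. of_nat (Poly_Mapping.lookup (Poly_Mapping.single j 1) i) * b i / x i)
      = (\<Sum>i\<in>UNIV. if i = j then b j / x j else 0)"
    by (rule sum.cong) (auto simp: lookup_single when_def)
  then show ?thesis
    using assms by (simp add: monom_deriv_def del: One_nat_def)
qed

lemma lin_ext_monom_val_times:
  "lin_ext (monom_val x) (p * q) = lin_ext (monom_val x) p * lin_ext (monom_val x) q"
  by (rule lin_ext_mult_hom) (rule monom_val_add)

lemma lin_ext_monom_deriv_times:
  "lin_ext (monom_deriv x b) (p * q) =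
     lin_ext (monom_val x) p * lin_ext (monom_deriv x b) q
     + lin_ext (monom_val x) q * lin_ext (monom_deriv x b) p"
  by (rule lin_ext_mult_derivation) (rule monom_deriv_add)

section \<open>Every element is a rational function of the generators\<close>

lemma subfield_generated_induct:
  assumes "a \<in> subfield_generated X" "is_subfield S" "X \<subseteq> S"
  shows "a \<in> S"
  using assms hull_minimal[of X S is_subfield] unfolding subfield_generated_def by blast

lemma is_subfield_fractions:
  fixes x :: "'n::finite \<Rightarrow> 'a::field"
  assumes K: "is_subfield K"
  defines "E \<equiv> lin_ext (monom_val x)"
  shows "is_subfield {E p / E q | p q. p \<in> polys_over K \<and> q \<in> polys_over K \<and> E q \<noteq> 0}"
    (is "is_subfield ?F")
proof -
  have frac: "a \<in> ?F" if "a = E p / E q" "p \<in> polys_over K" "q \<in> polys_over K" "E q \<noteq> 0" for a p q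
    using that by blast
  have K0: "0 \<in> K" using K by (auto simp: is_subfield_def)
  have one: "1 \<in> polys_over K" "E 1 = 1"
    by (auto simp: E_def lin_ext_1 polys_over_1[OF K])
  have zero: "0 \<in> polys_over K" "E 0 = 0"
    using K0 by (auto simp: polys_over_def E_def)
  have add: "E (p + q) = E p + E q" and diff: "E (p - q) = E p - E q"
    and times: "E (p * q) = E p * E q" for p q
    by (simp_all add: E_def lin_ext_add lin_ext_diff lin_ext_monom_val_times)
  note cl = polys_over_add[OF K] polys_over_diff[OF K] polys_over_times[OF K]
  have "0 \<in> ?F" by (rule frac[of _ 0 1]) (use one zero in auto)
  moreover have "1 \<in> ?F"
    by (rule frac[of _ 1 1]) (use one in auto)
  moreover have "a + b \<in> ?F \<and> a * b \<in> ?F" if a_in: "a \<in> ?F" and b_in: "b \<in> ?F" for a b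
  proof -
    obtain p q where a: "a = E p / E q" "p \<in> polys_over K" "q \<in> polys_over K" "E q \<noteq> 0"
      using a_in by blast
    obtain r s where b: "b = E r / E s" "r \<in> polys_over K" "s \<in> polys_over K" "E s \<noteq> 0"
      using b_in by blast
    show ?thesis
      by (intro conjI frac[of _ "p * s + r * q" "q * s"] frac[of _ "p * r" "q * s"])
        (use a b in \<open>auto simp: cl add times field_simps\<close>)
  qed
  moreover have "- a \<in> ?F \<and> inverse a \<in> ?F" if a_in: "a \<in> ?F" for a
  proof -
    obtain p q where a: "a = E p / E q" "p \<in> polys_over K" "q \<in> polys_over K" "E q \<noteq> 0"
      using a_in by blast
    have "- a \<in> ?F"
      by (rule frac[of _ "0 - p" q]) (use a zero diff[of 0 p] polys_over_diff[OF K, of 0 p] in auto)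
    moreover have "inverse a \<in> ?F"
    proof (cases "E p = 0")
      case True
      then show ?thesis using a \<open>0 \<in> ?F\<close> by simp
    next
      case False
      then show ?thesis by (intro frac[of _ q p]) (use a in auto)
    qed
    ultimately show ?thesis ..
  qed
  ultimately show ?thesis
    by (rule is_subfieldI)
qed

lemma generated_eq_fraction:
  fixes x :: "'n::finite \<Rightarrow> 'a::field"
  assumes "subfield_generated (range x) = UNIV" and K: "is_subfield K"
  obtains p q where "p \<in> polys_over K" "q \<in> polys_over K" "lin_ext (monom_val x) q \<noteq> 0"
    "\<phi> = lin_ext (monom_val x) p / lin_ext (monom_val x) q"
proof -
  let ?F = "{lin_ext (monom_val x) p / lin_ext (monom_val x) q | p q.
    p \<in> polys_over K \<and> q \<in> polys_over K \<and> lin_ext (monom_val x) q \<noteq> 0}"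
  have "1 \<in> K" using K by (simp add: is_subfield_def)
  then have *: "Poly_Mapping.single m 1 \<in> polys_over K" for m :: "'n \<Rightarrow>\<^sub>0 nat"
    by (rule polys_over_single[OF K])
  have "x j \<in> ?F" for j
    using *[of "Poly_Mapping.single j 1"] polys_over_1[OF K]
    by (intro CollectI exI[of _ "Poly_Mapping.single (Poly_Mapping.single j 1) 1"]
          exI[of _ 1])
      (simp add: lin_ext_single lin_ext_1 del: One_nat_def)
  then have "\<phi> \<in> ?F"
    using subfield_generated_induct[of \<phi> "range x" ?F] is_subfield_fractions[OF K, of x] assms(1)
    by blast
  then show ?thesis using that by blast
qed

section \<open>Derivations are determined by, and can be prescribed on, the generators\<close>

lemma derivation_add: "is_derivation L \<Longrightarrow> L (a + b) = L a + L b"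
  and derivation_mult: "is_derivation L \<Longrightarrow> L (a * b) = a * L b + b * L a"
  by (auto simp: is_derivation_def)

lemma derivation_0: "is_derivation L \<Longrightarrow> L 0 = 0"
  using derivation_add[of L 0 0] by (metis add_cancel_left_right add_0)

lemma derivation_1: "is_derivation L \<Longrightarrow> L 1 = 0"
  using derivation_mult[of L 1 1] by (metis add_cancel_left_right mult_1)

lemma derivation_minus: "is_derivation L \<Longrightarrow> L (- a) = - L a"
  using derivation_add[of L a "- a"] derivation_0[of L] by (simp add: eq_neg_iff_add_eq_0 add.commute)

lemma derivation_inverse:
  assumes "is_derivation L"
  shows "L (inverse a) = - L a * inverse a ^ 2"
proof (cases "a = 0")
  case False
  have "0 = a * L (inverse a) + inverse a * L a"
    using derivation_mult[OF assms, of a "inverse a"] derivation_1[OF assms] False by simp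
  then have "a * L (inverse a) = - inverse a * L a"
    by (simp add: eq_neg_iff_add_eq_0)
  then show ?thesis using False by (simp add: field_simps power2_eq_square)
qed (simp add: derivation_0[OF assms])

text \<open>The set on which two derivations agree is a subfield.\<close>

lemma derivation_eqI:
  assumes "is_derivation L" "is_derivation M" "\<And>a. a \<in> X \<Longrightarrow> L a = M a"
    and "subfield_generated X = UNIV"
  shows "L = M"
proof
  fix \<phi>
  have "is_subfield {a. L a = M a}"
    using assms(1,2) unfolding is_subfield_def
    by (simp add: derivation_0 derivation_1 derivation_add derivation_mult derivation_minus
        derivation_inverse)
  then show "L \<phi> = M \<phi>"
    using subfield_generated_induct[of \<phi> X "{a. L a = M a}"] assms(3,4) by blast
qed

lemma functionally_independentD:
  assumes "functionally_independent K x" "p \<in> polys_over K" "lin_ext (monom_val x) p = 0"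
  shows "p = 0"
  using assms unfolding functionally_independent_def eval_poly_eq_lin_ext polys_over_def by blast

text \<open>
  The derivation maps \<open>P(x) / Q(x)\<close> to the value given by the quotient rule. Functional
  independence makes this well defined.
\<close>

lemma derivation_extension:
  fixes x b :: "'n::finite \<Rightarrow> 'a::field"
  assumes gen: "subfield_generated (range x) = UNIV"
    and indep: "functionally_independent prime_field x"
    and nz: "\<And>j. x j \<noteq> 0"
  obtains L where "is_derivation L" "\<And>j. L (x j) = b j"
proof -
  define K :: "'a set" where "K = prime_field"
  have K: "is_subfield K"
    unfolding K_def prime_field_def by (rule is_subfield_subfield_generated)
  let ?R = "polys_over K :: (('n \<Rightarrow>\<^sub>0 nat) \<Rightarrow>\<^sub>0 'a) set"
  define E where "E = lin_ext (monom_val x)"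
  define D where "D = lin_ext (monom_deriv x b)"
  note cl = polys_over_add[OF K] polys_over_diff[OF K] polys_over_times[OF K]
  have E_add: "E (p + q) = E p + E q" and E_diff: "E (p - q) = E p - E q"
    and E_times: "E (p * q) = E p * E q" for p q
    by (simp_all add: E_def lin_ext_add lin_ext_diff lin_ext_monom_val_times)
  have D_add: "D (p + q) = D p + D q" and D_diff: "D (p - q) = D p - D q"
    and D_times: "D (p * q) = E p * D q + E q * D p" for p q
    by (simp_all add: D_def E_def lin_ext_add lin_ext_diff lin_ext_monom_deriv_times)
  \<comment> \<open>The quotient rule for \<open>\<phi> = p / q\<close> with derivative \<open>d\<close>, in a form free of division.\<close>
  define rep where "rep \<phi> d \<longleftrightarrow> (\<exists>p\<in>?R. \<exists>q\<in>?R. E q \<noteq> 0 \<and> E p = \<phi> * E q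
      \<and> D p = d * E q + \<phi> * D q)" for \<phi> d
  have rep_ex: "\<exists>d. rep \<phi> d" for \<phi>
  proof -
    obtain p q where pq: "p \<in> ?R" "q \<in> ?R" "E q \<noteq> 0" "\<phi> = E p / E q"
      using generated_eq_fraction[OF gen K, of \<phi>] unfolding E_def by metis
    then have "E p = \<phi> * E q" "D p = ((D p - \<phi> * D q) / E q) * E q + \<phi> * D q"
      by simp_all
    then show ?thesis
      unfolding rep_def using pq(1-3) by blast
  qed
  have rep_unique: "d = d'" if d: "rep \<phi> d" and d': "rep \<phi> d'" for \<phi> d d'
  proof -
    obtain p q where 1: "p \<in> ?R" "q \<in> ?R" "E q \<noteq> 0" "E p = \<phi> * E q" "D p = d * E q + \<phi> * D q"
      using d unfolding rep_def by blast
    obtain r s where 2: "r \<in> ?R" "s \<in> ?R" "E s \<noteq> 0" "E r = \<phi> * E s" "D r = d' * E s + \<phi> * D s"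
      using d' unfolding rep_def by blast
    have "E (p * s - r * q) = 0"
      unfolding E_diff E_times 1(4) 2(4) by (simp add: mult_ac)
    then have "p * s - r * q = 0"
      using functionally_independentD[OF indep, of "p * s - r * q"] cl 1(1,2) 2(1,2)
      unfolding K_def E_def by blast
    then have "D (p * s - r * q) = 0"
      by (simp add: D_def)
    moreover have "D (p * s - r * q) = (d - d') * (E q * E s)"
      unfolding D_diff D_times 1(4,5) 2(4,5) by (simp add: algebra_simps)
    ultimately show "d = d'"
      using 1(3) 2(3) by simp
  qed
  define L where "L \<phi> = (THE d. rep \<phi> d)" for \<phi>
  have L_eq: "L \<phi> = d" if "rep \<phi> d" for \<phi> d
    unfolding L_def using that rep_unique by blast
  have rep_L: "rep \<phi> (L \<phi>)" for \<phi>
    using rep_ex[of \<phi>] L_eq by blast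
  have "1 \<in> K" using K by (simp add: is_subfield_def)
  then have one: "1 \<in> ?R" "E 1 = 1"
    "D 1 = 0"
    by (auto simp: E_def D_def lin_ext_1 polys_over_1[OF K])
  have L_poly: "L (E p) = D p" if "p \<in> ?R" for p
    by (rule L_eq) (unfold rep_def, rule bexI[of _ p],
      rule bexI[of _ 1], use that one in auto)
  have L_add: "L (\<psi> + \<phi>) = L \<psi> + L \<phi>" and L_mult: "L (\<psi> * \<phi>) = \<psi> * L \<phi> + \<phi> * L \<psi>" for \<psi> \<phi>
  proof -
    obtain p q where 1: "p \<in> ?R" "q \<in> ?R" "E q \<noteq> 0" "E p = \<psi> * E q"
      "D p = L \<psi> * E q + \<psi> * D q"
      using rep_L[of \<psi>] unfolding rep_def by blast
    obtain r s where 2: "r \<in> ?R" "s \<in> ?R" "E s \<noteq> 0" "E r = \<phi> * E s"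
      "D r = L \<phi> * E s + \<phi> * D s"
      using rep_L[of \<phi>] unfolding rep_def by blast
    have R: "p * s + r * q \<in> ?R" "p * r \<in> ?R" "q * s \<in> ?R" and nz': "E (q * s) \<noteq> 0"
      using 1(1-3) 2(1-3) by (auto simp: cl E_times)
    have "E (p * s + r * q) = (\<psi> + \<phi>) * E (q * s)"
      unfolding E_add E_times 1(4) 2(4) by (simp add: algebra_simps)
    moreover have "D (p * s + r * q) = (L \<psi> + L \<phi>) * E (q * s) + (\<psi> + \<phi>) * D (q * s)"
      unfolding D_add D_times E_times 1(4,5) 2(4,5) by (simp add: algebra_simps)
    ultimately show "L (\<psi> + \<phi>) = L \<psi> + L \<phi>"
      using R nz' by (intro L_eq) (unfold rep_def, blast)
    have "E (p * r) = (\<psi> * \<phi>) * E (q * s)"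
      unfolding E_times 1(4) 2(4) by (simp add: algebra_simps)
    moreover have "D (p * r) = (\<psi> * L \<phi> + \<phi> * L \<psi>) * E (q * s) + (\<psi> * \<phi>) * D (q * s)"
      unfolding D_times E_times 1(4,5) 2(4,5) by (simp add: algebra_simps)
    ultimately show "L (\<psi> * \<phi>) = \<psi> * L \<phi> + \<phi> * L \<psi>"
      using R nz' by (intro L_eq) (unfold rep_def, blast)
  qed
  have L_const: "L c = 0" if "c \<in> prime_field" for c
    using L_poly[OF polys_over_single[OF K, of c 0]] that
    by (simp add: K_def E_def D_def lin_ext_single)
  have "L (x j) = b j" for j
    using L_poly[OF polys_over_single[OF K \<open>1 \<in> K\<close>, of "Poly_Mapping.single j 1"]]
    by (simp add: E_def D_def lin_ext_single monom_deriv_single nz del: One_nat_def)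
  moreover have "is_derivation L"
    unfolding is_derivation_def using L_add L_mult L_const by simp
  ultimately show ?thesis using that by blast
qed

section \<open>The basis of partial derivatives\<close>

lemma sum_scale_map_apply:
  "(\<Sum>i\<in>I. scale_map (c i) (f i)) \<phi> = (\<Sum>i\<in>I. c i * f i \<phi>)"
  by (induction I rule: infinite_finite_induct) (auto simp: scale_map_def)

lemma partial_derivation:
  fixes x :: "'n::finite \<Rightarrow> 'a::field"
  assumes gen: "subfield_generated (range x) = UNIV"
    and indep: "functionally_independent prime_field x"
    and nz: "\<And>j. x j \<noteq> 0"
  shows "is_derivation (partial x i)" "partial x i (x j) = (if i = j then 1 else 0)"
proof -
  let ?P = "\<lambda>D. is_derivation D \<and> (\<forall>j. D (x j) = (if i = j then 1 else 0))"
  obtain D where D: "is_derivation D" "\<And>j. D (x j) = (if i = j then 1 else 0)"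
    using derivation_extension[OF assms, of "\<lambda>j. if i = j then 1 else 0"] by blast
  have "?P (partial x i)"
    unfolding partial_def
  proof (rule theI[of ?P D])
    show "?P D" using D by blast
    show "M = D" if "?P M" for M
      by (rule derivation_eqI[OF _ _ _ gen]) (use that D in auto)
  qed
  then show "is_derivation (partial x i)" "partial x i (x j) = (if i = j then 1 else 0)"
    by auto
qed

theorem mainTheorem1:
  fixes x :: "'n::finite \<Rightarrow> 'a::{field_char_0, order}"
  assumes distinct: "inj x"
    and nontrivial: "\<And>i. x i \<noteq> 0 \<and> x i \<noteq> 1"
    and generates: "subfield_generated (range x) = UNIV"
    and independent: "functionally_independent prime_field x"
    and add_strict: "\<And>\<psi>1 \<psi>2 \<phi>1 \<phi>2 :: 'a. \<psi>1 > \<psi>2 \<Longrightarrow> \<phi>1 \<ge> \<phi>2 \<Longrightarrow> \<psi>1 + \<phi>1 > \<psi>2 + \<phi>2"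
    and square_nonneg: "\<And>\<psi> :: 'a. \<psi>\<^sup>2 \<ge> 0"
  shows "maps.independent (range (partial x)) \<and> maps.span (range (partial x)) = derivations
    \<and> inj (partial x)
    \<and> maps.dim (derivations :: ('a \<Rightarrow> 'a) set) = CARD('n)
    \<and> (\<forall>L\<in>derivations. L = (\<Sum>i\<in>UNIV. scale_map (L (x i)) (partial x i)))
    \<and> (\<forall>a :: 'a ^ 'n. coords x (\<Sum>i\<in>UNIV. scale_map (a $ i) (partial x i)) = a)
    \<and> linear_iso_on scale_map (*s) derivations (UNIV :: ('a ^ 'n) set) (coords x)
    \<and> (\<forall>L\<in>derivations. \<forall>\<phi>. L \<phi> = pairing (coords x L) (gradient x \<phi>))"
proof -
  let ?B = "range (partial x)"
  define comb where "comb a = (\<Sum>i\<in>UNIV. scale_map (a i) (partial x i))" for a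
  have nz: "x j \<noteq> 0" for j using nontrivial by blast
  note pd = partial_derivation[OF generates independent nz]
  have B_sub: "?B \<subseteq> derivations" by (auto simp: derivations_def pd(1))
  have comb_in: "comb a \<in> derivations" for a
    unfolding comb_def
    by (intro maps.subspace_sum maps.subspace_scale subspace_derivations) (use B_sub in auto)
  have comb_x: "comb a (x j) = a j" for a j
    unfolding comb_def by (simp add: sum_scale_map_apply pd(2) if_distrib cong: if_cong)
  have L_comb: "L = comb (\<lambda>i. L (x i))" if "L \<in> derivations" for L
    by (rule derivation_eqI[OF _ _ _ generates])
      (use that comb_in in \<open>auto simp: comb_x derivations_def\<close>)
  have inj: "inj (partial x)"
  proof (rule injI)
    fix i j assume "partial x i = partial x j"
    then have "partial x i (x i) = partial x j (x i)" by (rule fun_cong)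
    then show "i = j" unfolding pd(2) by (auto split: if_splits)
  qed
  have sum_B: "(\<Sum>v\<in>?B. scale_map (u v) v) = comb (\<lambda>i. u (partial x i))" for u
    unfolding comb_def sum.reindex[OF inj] comp_def ..
  have ind: "maps.independent ?B"
  proof (rule maps.independent_if_scalars_zero)
    fix u v assume "(\<Sum>v\<in>?B. scale_map (u v) v) = 0" "v \<in> ?B"
    then show "u v = 0"
      using comb_x[of "\<lambda>i. u (partial x i)"] unfolding sum_B by (auto simp: zero_fun_def)
  qed simp
  have comb_span: "comb a \<in> maps.span ?B" for a
    unfolding comb_def by (intro maps.span_sum maps.span_scale maps.span_base) auto
  have span: "maps.span ?B = derivations"
  proof
    show "maps.span ?B \<subseteq> derivations"
      by (rule maps.span_minimal[OF B_sub subspace_derivations])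
    show "derivations \<subseteq> maps.span ?B"
      using L_comb comb_span by (metis subsetI)
  qed
  have dim: "maps.dim (derivations :: ('a \<Rightarrow> 'a) set) = CARD('n)"
    using maps.dim_span_eq_card_independent[OF ind] card_image[OF inj] span by simp
  have coords: "coords x L $ i = L (x i)" if "L \<in> derivations" for L i
  proof -
    have "L = (\<Sum>v\<in>?B. scale_map (maps.representation ?B L v) v)"
      using maps.sum_representation_eq[OF ind, of L ?B] that span by simp
    then have "L = comb (\<lambda>i. maps.representation ?B L (partial x i))"
      unfolding sum_B .
    then show ?thesis
      unfolding coords_def using comb_x by (metis vec_lambda_beta)
  qed
  have coords_comb: "coords x (comb (\<lambda>i. a $ i)) = a" for a :: "'a ^ 'n"
    by (simp add: vec_eq_iff coords[OF comb_in] comb_x)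
  have iso: "linear_iso_on scale_map (*s) derivations (UNIV :: ('a ^ 'n) set) (coords x)"
    unfolding linear_iso_on_def
  proof (intro conjI ballI allI)
    fix u v :: "'a \<Rightarrow> 'a" assume "u \<in> derivations" "v \<in> derivations"
    moreover from this have "u + v \<in> derivations"
      by (rule maps.subspace_add[OF subspace_derivations])
    ultimately show "coords x (u + v) = coords x u + coords x v"
      unfolding vec_eq_iff vector_add_component by (simp only: coords plus_fun_def simp_thms)
  next
    fix c and v :: "'a \<Rightarrow> 'a" assume "v \<in> derivations"
    moreover from this have "scale_map c v \<in> derivations"
      by (rule maps.subspace_scale[OF subspace_derivations])
    ultimately show "coords x (scale_map c v) = c *s coords x v"
      unfolding vec_eq_iff vector_smult_component by (simp only: coords scale_map_def simp_thms)
  next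
    show "bij_betw (coords x) derivations UNIV"
    proof (rule bij_betw_byWitness[where f' = "\<lambda>a. comb (\<lambda>i. a $ i)"])
      show "\<forall>L\<in>derivations. comb (\<lambda>i. coords x L $ i) = L"
        using L_comb by (metis (no_types, lifting) coords ext)
      show "\<forall>a\<in>UNIV. coords x (comb (\<lambda>i. a $ i)) = a"
        using coords_comb by blast
      show "(\<lambda>a. comb (\<lambda>i. a $ i)) ` UNIV \<subseteq> derivations"
        using comb_in by blast
    qed blast
  qed
  have grad: "L \<phi> = pairing (coords x L) (gradient x \<phi>)" if "L \<in> derivations" for L \<phi>
  proof -
    have "L \<phi> = comb (\<lambda>i. L (x i)) \<phi>" using L_comb[OF that] by simp
    then show ?thesis
      by (simp add: comb_def sum_scale_map_apply pairing_def gradient_def coords[OF that])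
  qed
  show ?thesis
  proof (intro conjI ballI allI)
    show "L = (\<Sum>i\<in>UNIV. scale_map (L (x i)) (partial x i))" if "L \<in> derivations" for L
      using L_comb[OF that] unfolding comb_def .
    show "coords x (\<Sum>i\<in>UNIV. scale_map (a $ i) (partial x i)) = a" for a
      using coords_comb[of a] unfolding comb_def .
  qed (use ind span inj dim iso grad in blast)+
qed

end
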